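(* Let $H$ be a DAT-free digraph. Then $H$ admits a binary polymorphism $f$ and a ternary polymorphism $g$ such that for any two distinct vertices $u,v$ of $H$: if $u,v$ is not an invertible pair then $f|_{\{u,v\}}$ is a semi-lattice, and if $u,v$ is an invertible pair then $g|_{\{u,v\}}$ is a majority.
   Context: A digraph $H$ is a finite set $V(H)$ with a binary relation $E(H)$ (arcs). A polymorphism of $H$ of order $k$ is a map $f:V(H)^k\to V(H)$ such that whenever $u_1v_1,\dots,u_kv_k\in E(H)$, also $f(u_1,\dots,u_k)f(v_1,\dots,v_k)\in E(H)$. $f|_{\{u,v\}}$ denotes the restriction to $\{u,v\}^k$. A binary restriction is a semi-lattice if it is commutative and associative on $\{u,v\}$ (with $f(a,a)=a$); a ternary restriction is a majority if $g(a,a,b)=g(a,b,a)=g(b,a,a)=a$ for all $a,b\in\{u,v\}$. A walk in $H$ is a sequence $x_0,\dots,x_n$ of vertices together with, for each $i$, a designation of step $i$ as forward (requiring $x_ix_{i+1}\in E(H)$) or backward (requiring $x_{i+1}x_i\in E(H)$). Two walks $P=x_0,\dots,x_n$ and $Q=y_0,\dots,y_n$ are congruent if for every $i$ step $i$ of $P$ is forward iff step $i$ of $Q$ is forward. For congruent $P,Q$, $P$ avoids $Q$ if there is no $i$ with step $i$ forward and $x_iy_{i+1}\in E(H)$, and no $i$ with step $i$ backward and $y_{i+1}x_i\in E(H)$. Two distinct vertices $u,v$ form an invertible pair if there exist congruent walks $P$ from $u$ to $v$ and $Q$ from $v$ to $u$ with $P$ avoiding $Q$, and congruent walks $P'$ from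 $v$ to $u$ and $Q'$ from $u$ to $v$ with $P'$ avoiding $Q'$. A permutable triple consists of three distinct vertices $u,v,w$ together with six vertices $s(u),b(u),s(v),b(v),s(w),b(w)$ such that for each $x\in\{u,v,w\}$, with $y,z$ the other two, there exist a walk $P(x,s(x))$ from $x$ to $s(x)$ and walks $P(y,b(x))$, $P(z,b(x))$ from $y$, resp. $z$, to $b(x)$, both congruent to $P(x,s(x))$, such that $P(x,s(x))$ avoids both. A DAT is a permutable triple in which each pair $s(u),b(u)$; $s(v),b(v)$; $s(w),b(w)$ is invertible; $H$ is DAT-free if it contains no DAT. *)

theory Defs
  imports "Graph_Theory.Pair_Digraph"
begin

section \<open>Polymorphisms and their binary restrictions\<close>

text \<open>
  An operation of order \<open>k\<close> takes its arguments as a list of length \<open>k\<close>; its values on lists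
  of any other length, or on lists containing non-vertices, are irrelevant.
\<close>

definition polymorphism :: "'a pair_pre_digraph \<Rightarrow> nat \<Rightarrow> ('a list \<Rightarrow> 'a) \<Rightarrow> bool" where
  "polymorphism H k f \<longleftrightarrow>
     (\<forall>us. length us = k \<and> set us \<subseteq> pverts H \<longrightarrow> f us \<in> pverts H) \<and>
     (\<forall>us vs. length us = k \<and> length vs = k \<and> (\<forall>i<k. (us ! i, vs ! i) \<in> parcs H)
        \<longrightarrow> (f us, f vs) \<in> parcs H)"

text \<open>
  A semi-lattice on \<open>S\<close> is an operation on \<open>S\<close>, so \<open>S\<close> has to be closed under it.
\<close>

definition semilattice_on :: "('a list \<Rightarrow> 'a) \<Rightarrow> 'a set \<Rightarrow> bool" where
  "semilattice_on f S \<longleftrightarrow>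
     (\<forall>a\<in>S. \<forall>b\<in>S. f [a, b] \<in> S) \<and>
     (\<forall>a\<in>S. f [a, a] = a) \<and>
     (\<forall>a\<in>S. \<forall>b\<in>S. f [a, b] = f [b, a]) \<and>
     (\<forall>a\<in>S. \<forall>b\<in>S. \<forall>c\<in>S. f [f [a, b], c] = f [a, f [b, c]])"

definition majority_on :: "('a list \<Rightarrow> 'a) \<Rightarrow> 'a set \<Rightarrow> bool" where
  "majority_on g S \<longleftrightarrow>
     (\<forall>a\<in>S. \<forall>b\<in>S. g [a, a, b] = a \<and> g [a, b, a] = a \<and> g [b, a, a] = a)"

section \<open>Walks\<close>

datatype direction = Forward | Backward

text \<open>
  The walk \<open>x\<^sub>0, \<dots>, x\<^sub>n\<close> is the pair of the list of its \<open>n + 1\<close> vertices and the list of the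
  directions of its \<open>n\<close> steps; arcs may be traversed in either direction.
\<close>

type_synonym 'a dwalk = "'a list \<times> direction list"

fun is_step :: "'a pair_pre_digraph \<Rightarrow> direction \<Rightarrow> 'a \<Rightarrow> 'a \<Rightarrow> bool" where
  "is_step H Forward x y \<longleftrightarrow> (x, y) \<in> parcs H"
| "is_step H Backward x y \<longleftrightarrow> (y, x) \<in> parcs H"

definition dwalk :: "'a pair_pre_digraph \<Rightarrow> 'a dwalk \<Rightarrow> bool" where
  "dwalk H P \<longleftrightarrow>
     length (fst P) = Suc (length (snd P)) \<and> set (fst P) \<subseteq> pverts H \<and>
     (\<forall>i < length (snd P). is_step H (snd P ! i) (fst P ! i) (fst P ! Suc i))"

definition dwalk_from_to :: "'a pair_pre_digraph \<Rightarrow> 'a \<Rightarrow> 'a dwalk \<Rightarrow> 'a \<Rightarrow> bool" where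
  "dwalk_from_to H x P y \<longleftrightarrow> dwalk H P \<and> hd (fst P) = x \<and> last (fst P) = y"

definition congruent_walks :: "'a dwalk \<Rightarrow> 'a dwalk \<Rightarrow> bool" where
  "congruent_walks P Q \<longleftrightarrow> snd P = snd Q"

text \<open>
  Avoidance is only meaningful for congruent walks; the vertex of \<open>P\<close> before step \<open>i\<close> is
  compared with the vertex of \<open>Q\<close> after it, so the relation is not symmetric.
\<close>

definition avoids :: "'a pair_pre_digraph \<Rightarrow> 'a dwalk \<Rightarrow> 'a dwalk \<Rightarrow> bool" where
  "avoids H P Q \<longleftrightarrow>
     \<not> (\<exists>i < length (snd P). is_step H (snd P ! i) (fst P ! i) (fst Q ! Suc i))"

section \<open>Invertible pairs, permutable triples and DATs\<close>

definition invertible_pair :: "'a pair_pre_digraph \<Rightarrow> 'a \<Rightarrow> 'a \<Rightarrow> bool" where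
  "invertible_pair H u v \<longleftrightarrow>
     u \<in> pverts H \<and> v \<in> pverts H \<and> u \<noteq> v \<and>
     (\<exists>P Q. dwalk_from_to H u P v \<and> dwalk_from_to H v Q u \<and>
        congruent_walks P Q \<and> avoids H P Q) \<and>
     (\<exists>P' Q'. dwalk_from_to H v P' u \<and> dwalk_from_to H u Q' v \<and>
        congruent_walks P' Q' \<and> avoids H P' Q')"

text \<open>
  The functions \<open>s\<close> and \<open>b\<close> matter only at \<open>u\<close>, \<open>v\<close> and \<open>w\<close>.
\<close>

definition permutable_triple ::
  "'a pair_pre_digraph \<Rightarrow> 'a \<Rightarrow> 'a \<Rightarrow> 'a \<Rightarrow> ('a \<Rightarrow> 'a) \<Rightarrow> ('a \<Rightarrow> 'a) \<Rightarrow> bool" where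
  "permutable_triple H u v w s b \<longleftrightarrow>
     {u, v, w} \<subseteq> pverts H \<and> u \<noteq> v \<and> u \<noteq> w \<and> v \<noteq> w \<and>
     s ` {u, v, w} \<subseteq> pverts H \<and> b ` {u, v, w} \<subseteq> pverts H \<and>
     (\<forall>x \<in> {u, v, w}. \<exists>P. dwalk_from_to H x P (s x) \<and>
        (\<forall>y \<in> {u, v, w} - {x}. \<exists>Q. dwalk_from_to H y Q (b x) \<and>
           congruent_walks Q P \<and> avoids H P Q))"

definition DAT ::
  "'a pair_pre_digraph \<Rightarrow> 'a \<Rightarrow> 'a \<Rightarrow> 'a \<Rightarrow> ('a \<Rightarrow> 'a) \<Rightarrow> ('a \<Rightarrow> 'a) \<Rightarrow> bool" where
  "DAT H u v w s b \<longleftrightarrow>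
     permutable_triple H u v w s b \<and> (\<forall>x \<in> {u, v, w}. invertible_pair H (s x) (b x))"

definition DAT_free :: "'a pair_pre_digraph \<Rightarrow> bool" where
  "DAT_free H \<longleftrightarrow> \<not> (\<exists>u v w s b. DAT H u v w s b)"

end

theory Submission
  imports Defs
begin

text \<open>
  Pairs \<open>(u, v)\<close> are made into a digraph whose directed walks are the pairs of congruent walks
  the first of which avoids the second; reversing arcs and swapping both pairs maps it to itself.
  A conservative binary operation is a polymorphism iff the set of pairs on which it is the first
  projection is closed under these arcs, so \<open>f\<close> comes from a maximal closed set that contains all
  invertible pairs and never contains both orientations of any other pair; \<open>f\<close> is then the first
  projection on invertible pairs.

  Applying \<open>f\<close> to two coordinates at a time retracts the triples onto those whose entries are
  pairwise equal or invertible. On such triples let \<open>g\<close> select the first entry that cannot be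
  carried, along congruent walks on which it avoids the other two, to \<open>(s, b, b)\<close> with
  \<open>s, b\<close> invertible; absence of DATs means that such an entry exists. If \<open>x \<rightarrow> y\<close> are arcs in each
  coordinate and \<open>x\<^sub>i\<close>, \<open>y\<^sub>j\<close> are selected without \<open>x\<^sub>i y\<^sub>j\<close> being an arc, then neither
  \<open>x\<^sub>i y\<^sub>k\<close> nor \<open>x\<^sub>k y\<^sub>j\<close> is an arc, as otherwise one step leads \<open>y\<^sub>j\<close> to \<open>(x\<^sub>j, x\<^sub>i, x\<^sub>i)\<close>, or \<open>x\<^sub>i\<close> to
  \<open>(y\<^sub>i, y\<^sub>j, y\<^sub>j)\<close>. Hence the step between \<open>x\<close> and \<open>y\<close> shows that both \<open>i\<close> and \<open>j\<close> were eligible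
  at both \<open>x\<close> and \<open>y\<close>, contradicting the choice of the first one.
\<close>

section \<open>The pair digraph\<close>

lemma dwalk_from_to_Nil:
  "dwalk_from_to H x (xs, []) y \<longleftrightarrow> xs = [x] \<and> y = x \<and> x \<in> pverts H"
  by (cases xs) (auto simp: dwalk_from_to_def dwalk_def)

lemma dwalk_from_to_Cons:
  "dwalk_from_to H x (x' # xs, d # ds) y \<longleftrightarrow>
     x' = x \<and> x \<in> pverts H \<and> is_step H d x (hd xs) \<and> dwalk_from_to H (hd xs) (xs, ds) y"
proof (cases xs)
  case Nil
  then show ?thesis by (auto simp: dwalk_from_to_def dwalk_def)
next
  case (Cons z zs)
  then show ?thesis
    by (auto simp: dwalk_from_to_def dwalk_def All_less_Suc2)
qed

lemma avoids_Nil: "avoids H (xs, []) Q"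
  by (simp add: avoids_def)

text \<open>Directions are read off the first walk alone, so \<open>e\<close> and \<open>e'\<close>
  are arbitrary.\<close>

lemma avoids_Cons:
  assumes "ys \<noteq> []"
  shows "avoids H (x # xs, d # ds) (y # ys, e) \<longleftrightarrow>
    \<not> is_step H d x (hd ys) \<and> avoids H (xs, ds) (ys, e')"
  using assms by (cases ys) (auto simp: avoids_def Ex_less_Suc2)

definition avoiding_arcs :: "'a pair_pre_digraph \<Rightarrow> (('a \<times> 'a) \<times> ('a \<times> 'a)) set" where
  "avoiding_arcs H = {((u, v), (u', v')). \<exists>d. is_step H d u u' \<and> is_step H d v v' \<and> \<not> is_step H d u v'}"

text \<open>Traversed in the opposite direction, the step forbidden from \<open>u\<close> to
  \<open>v'\<close> is the one forbidden from \<open>v'\<close> to \<open>u\<close>.\<close>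

lemma avoiding_arcs_skew:
  assumes "((u, v), (u', v')) \<in> avoiding_arcs H"
  shows "((v', u'), (v, u)) \<in> avoiding_arcs H"
proof -
  obtain d where d: "is_step H d u u'" "is_step H d v v'" "\<not> is_step H d u v'"
    using assms by (auto simp: avoiding_arcs_def)
  define e where "e = (case d of Forward \<Rightarrow> Backward | Backward \<Rightarrow> Forward)"
  have "is_step H e x y = is_step H d y x" for x y
    unfolding e_def by (cases d) auto
  then show ?thesis using d by (auto simp: avoiding_arcs_def)
qed

lemma avoiding_reach_skew:
  assumes "((u, v), (u', v')) \<in> (avoiding_arcs H)\<^sup>*"
  shows "((v', u'), (v, u)) \<in> (avoiding_arcs H)\<^sup>*"
  using assms
proof (induction rule: rtrancl_induct2)
  case (step a b c d)
  then show ?case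
    by (meson avoiding_arcs_skew converse_rtrancl_into_rtrancl)
qed simp

lemma is_step_verts:
  assumes "pair_fin_digraph H" "is_step H d x y"
  shows "x \<in> pverts H" "y \<in> pverts H"
proof -
  interpret pair_fin_digraph H by fact
  show "x \<in> pverts H" "y \<in> pverts H"
    using assms(2) by (cases d; auto dest: in_arcsD1 in_arcsD2)+
qed

lemma avoiding_reach_imp_walks:
  assumes "pair_fin_digraph H" and "((u, v), (u', v')) \<in> (avoiding_arcs H)\<^sup>*"
    and "u' \<in> pverts H" "v' \<in> pverts H"
  shows "\<exists>P Q. dwalk_from_to H u P u' \<and> dwalk_from_to H v Q v' \<and> congruent_walks P Q \<and> avoids H P Q"
  using assms(2)
proof (induction rule: converse_rtrancl_induct2)
  case refl
  have "dwalk_from_to H u' ([u'], []) u'" "dwalk_from_to H v' ([v'], []) v'"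
    using assms by (auto simp: dwalk_from_to_Nil)
  then show ?case
    using avoids_Nil unfolding congruent_walks_def by (metis snd_conv)
next
  case (step a b c d)
  obtain e where e: "is_step H e a c" "is_step H e b d" "\<not> is_step H e a d"
    using step.hyps(1) by (auto simp: avoiding_arcs_def)
  obtain xs ys ds where w: "dwalk_from_to H c (xs, ds) u'" "dwalk_from_to H d (ys, ds) v'"
    "avoids H (xs, ds) (ys, ds)"
    using step.IH by (auto simp: congruent_walks_def)
  have hd: "hd xs = c" "hd ys = d" "ys \<noteq> []"
    using w by (auto simp: dwalk_from_to_def dwalk_def)
  have "dwalk_from_to H a (a # xs, e # ds) u'" "dwalk_from_to H b (b # ys, e # ds) v'"
    using w e hd is_step_verts[OF assms(1)] by (auto simp: dwalk_from_to_Cons)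
  moreover have "avoids H (a # xs, e # ds) (b # ys, e # ds)"
    using w e hd avoids_Cons[OF hd(3)] by metis
  ultimately show ?case
    unfolding congruent_walks_def by (metis snd_conv)
qed

lemma walks_imp_avoiding_reach:
  assumes "dwalk_from_to H u (xs, ds) u'" "dwalk_from_to H v (ys, ds) v'"
    "avoids H (xs, ds) (ys, ds)"
  shows "((u, v), (u', v')) \<in> (avoiding_arcs H)\<^sup>*"
  using assms
proof (induction ds arbitrary: u v xs ys)
  case Nil
  then show ?case by (simp add: dwalk_from_to_Nil)
next
  case (Cons d ds)
  obtain xs' ys' where xy: "xs = u # xs'" "ys = v # ys'"
    using Cons.prems by (cases xs; cases ys) (auto simp: dwalk_from_to_def dwalk_def)
  have w: "is_step H d u (hd xs')" "dwalk_from_to H (hd xs') (xs', ds) u'"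
    "is_step H d v (hd ys')" "dwalk_from_to H (hd ys') (ys', ds) v'"
    using Cons.prems unfolding xy by (auto simp: dwalk_from_to_Cons)
  have "ys' \<noteq> []" using w by (auto simp: dwalk_from_to_def dwalk_def)
  then have a: "\<not> is_step H d u (hd ys')" "avoids H (xs', ds) (ys', ds)"
    using Cons.prems(3) avoids_Cons unfolding xy by metis+
  have "((u, v), (hd xs', hd ys')) \<in> avoiding_arcs H"
    using w a by (auto simp: avoiding_arcs_def)
  with Cons.IH[OF w(2,4) a(2)] show ?case by (rule converse_rtrancl_into_rtrancl[rotated])
qed

lemma invertible_pair_iff_reach:
  assumes "pair_fin_digraph H"
  shows "invertible_pair H u v \<longleftrightarrow> u \<in> pverts H \<and> v \<in> pverts H \<and> u \<noteq> v \<and>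
    ((u, v), (v, u)) \<in> (avoiding_arcs H)\<^sup>* \<and> ((v, u), (u, v)) \<in> (avoiding_arcs H)\<^sup>*"
proof -
  have "(\<exists>P Q. dwalk_from_to H u P v \<and> dwalk_from_to H v Q u \<and> congruent_walks P Q \<and> avoids H P Q) \<longleftrightarrow>
      ((u, v), (v, u)) \<in> (avoiding_arcs H)\<^sup>*" if "u \<in> pverts H" "v \<in> pverts H" for u v
    using avoiding_reach_imp_walks[OF assms _ that(2,1)]
    by (auto simp: congruent_walks_def dest: walks_imp_avoiding_reach)
  then show ?thesis unfolding invertible_pair_def by blast
qed

lemma invertible_pair_commute: "invertible_pair H u v \<longleftrightarrow> invertible_pair H v u"
  unfolding invertible_pair_def by blast

section \<open>The binary polymorphism\<close>

lemma exists_closed_selection: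
  assumes H: "pair_fin_digraph H"
  obtains F where "avoiding_arcs H `` F \<subseteq> F"
    and "\<And>u v. invertible_pair H u v \<Longrightarrow> (u, v) \<in> F"
    and "\<And>u v. \<lbrakk>u \<in> pverts H; v \<in> pverts H; u \<noteq> v; \<not> invertible_pair H u v\<rbrakk>
      \<Longrightarrow> (u, v) \<in> F \<longleftrightarrow> (v, u) \<notin> F"
proof -
  interpret pair_fin_digraph H by fact
  let ?V = "pverts H" and ?R = "avoiding_arcs H"
  note inv = invertible_pair_iff_reach[OF H]
  define conflict where "conflict D \<longleftrightarrow> (\<exists>u\<in>?V. \<exists>v\<in>?V. u \<noteq> v \<and> \<not> invertible_pair H u v \<and>
    (u, v) \<in> D \<and> (v, u) \<in> D)" for D
  define I where "I = {(u, v). invertible_pair H u v}"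
  define \<D> where "\<D> = {D. D \<subseteq> ?V \<times> ?V \<and> ?R `` D \<subseteq> D \<and> I \<subseteq> D \<and> \<not> conflict D}"
  have arc_verts: "a \<in> ?V \<and> b \<in> ?V \<and> c \<in> ?V \<and> d \<in> ?V" if "((a, b), (c, d)) \<in> ?R" for a b c d
    using that is_step_verts[OF H] by (auto simp: avoiding_arcs_def)
  have closure_verts: "?R\<^sup>* `` D \<subseteq> ?V \<times> ?V" if "D \<subseteq> ?V \<times> ?V" for D
  proof -
    have "q \<in> ?V \<times> ?V" if "(p, q) \<in> ?R\<^sup>*" "p \<in> ?V \<times> ?V" for p q
      using that by (induction rule: rtrancl_induct) (auto dest: arc_verts)
    then show ?thesis using that by blast
  qed
  have closed_reach: "q \<in> D" if "(p, q) \<in> ?R\<^sup>*" "p \<in> D" "?R `` D \<subseteq> D" for p q D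
    using that by (induction rule: rtrancl_induct) auto
  have "?R\<^sup>* `` I \<in> \<D>"
  proof -
    have "\<not> conflict (?R\<^sup>* `` I)"
    proof
      assume "conflict (?R\<^sup>* `` I)"
      then obtain u v a b c d where *: "u \<in> ?V" "v \<in> ?V" "u \<noteq> v" "\<not> invertible_pair H u v"
        "invertible_pair H a b" "((a, b), (u, v)) \<in> ?R\<^sup>*"
        "invertible_pair H c d" "((c, d), (v, u)) \<in> ?R\<^sup>*"
        unfolding conflict_def I_def by auto
      \<comment> \<open>Skew symmetry and invertibility of \<open>c\<close>, \<open>d\<close> lead
        from \<open>(u, v)\<close> via \<open>(d, c)\<close> and \<open>(c, d)\<close> to
        \<open>(v, u)\<close>; \<open>a\<close>, \<open>b\<close> give the way back, so
        \<open>u\<close>, \<open>v\<close> is invertible after all.\<close>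
      have "((u, v), (d, c)) \<in> ?R\<^sup>*" "((d, c), (c, d)) \<in> ?R\<^sup>*"
        using avoiding_reach_skew[OF *(8)] *(7) inv by auto
      then have 1: "((u, v), (v, u)) \<in> ?R\<^sup>*" using *(8) by (meson rtrancl_trans)
      have "((v, u), (b, a)) \<in> ?R\<^sup>*" "((b, a), (a, b)) \<in> ?R\<^sup>*"
        using avoiding_reach_skew[OF *(6)] *(5) inv by auto
      then have 2: "((v, u), (u, v)) \<in> ?R\<^sup>*" using *(6) by (meson rtrancl_trans)
      show False using 1 2 * inv by blast
    qed
    moreover have "I \<subseteq> ?V \<times> ?V" by (auto simp: I_def invertible_pair_def)
    ultimately show ?thesis
      unfolding \<D>_def using closure_verts by (auto intro: rtrancl_into_rtrancl)
  qed
  moreover have "finite \<D>"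
    by (rule finite_subset[of _ "Pow (?V \<times> ?V)"]) (auto simp: \<D>_def)
  ultimately obtain D where D: "D \<in> \<D>" and max: "\<And>D'. D' \<in> \<D> \<Longrightarrow> D \<subseteq> D' \<Longrightarrow> D' = D"
    using finite_has_maximal[of \<D>] by blast
  have decided: "(u, v) \<in> D \<or> (v, u) \<in> D"
    if uv: "u \<in> ?V" "v \<in> ?V" and nr: "((u, v), (v, u)) \<notin> ?R\<^sup>*" for u v
  proof (rule ccontr)
    assume "\<not> ?thesis"
    then have n: "(u, v) \<notin> D" "(v, u) \<notin> D" by auto
    \<comment> \<open>By maximality of \<open>D\<close> it suffices that adding everything reachable
      from \<open>(u, v)\<close> creates no conflict.\<close>
    let ?D = "D \<union> ?R\<^sup>* `` {(u, v)}"
    have "\<not> conflict ?D"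
    proof
      assume "conflict ?D"
      then obtain p q where pq: "p \<in> ?V" "q \<in> ?V" "p \<noteq> q" "\<not> invertible_pair H p q"
        "(p, q) \<in> ?D" "(q, p) \<in> ?D"
        unfolding conflict_def by blast
      have nD: "\<not> ((p, q) \<in> D \<and> (q, p) \<in> D)"
        using D pq(1-4) unfolding \<D>_def conflict_def by blast
      \<comment> \<open>The skew path leads from \<open>(b, a)\<close> to \<open>(v, u)\<close>,
        which lies outside the closed set \<open>D\<close>.\<close>
      have esc: "(b, a) \<notin> D" if "((u, v), (a, b)) \<in> ?R\<^sup>*" for a b
        using closed_reach[OF avoiding_reach_skew[OF that]] n(2) D unfolding \<D>_def by blast
      \<comment> \<open>A conflict can thus only be between two reachable pairs. The skew of the
        path to \<open>(q, p)\<close> continues the path to \<open>(p, q)\<close> as far as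
        \<open>(v, u)\<close>.\<close>
      have "((u, v), (p, q)) \<in> ?R\<^sup>*" "((u, v), (q, p)) \<in> ?R\<^sup>*"
        using pq(5,6) nD esc by blast+
      then have "((u, v), (v, u)) \<in> ?R\<^sup>*"
        using avoiding_reach_skew rtrancl_trans by metis
      then show False using nr by blast
    qed
    moreover have "?R\<^sup>* `` {(u, v)} \<subseteq> ?V \<times> ?V" using closure_verts uv by auto
    ultimately have "?D \<in> \<D>"
      using D unfolding \<D>_def by (auto intro: rtrancl_into_rtrancl)
    then have "?D = D" using max by blast
    then show False using n by blast
  qed
  show ?thesis
  proof
    show "?R `` D \<subseteq> D" "\<And>u v. invertible_pair H u v \<Longrightarrow> (u, v) \<in> D"
      using D unfolding \<D>_def I_def by auto
    fix u v assume uv: "u \<in> ?V" "v \<in> ?V" "u \<noteq> v" "\<not> invertible_pair H u v"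
    \<comment> \<open>A non-invertible pair fails to reach its swap from at least one orientation,
      and \<open>decided\<close> may start from either.\<close>
    have "(u, v) \<in> D \<or> (v, u) \<in> D" using decided uv inv by blast
    moreover have "\<not> ((u, v) \<in> D \<and> (v, u) \<in> D)"
      using D uv unfolding \<D>_def conflict_def by blast
    ultimately show "(u, v) \<in> D \<longleftrightarrow> (v, u) \<notin> D" by blast
  qed
qed

lemma exists_binary_polymorphism:
  assumes H: "pair_fin_digraph H"
  obtains f where "\<And>a b. f a b \<in> {a, b}"
    and "\<And>a b c d. \<lbrakk>(a, c) \<in> parcs H; (b, d) \<in> parcs H\<rbrakk> \<Longrightarrow> (f a b, f c d) \<in> parcs H"
    and "\<And>a b. invertible_pair H a b \<Longrightarrow> f a b = a"
    and "\<And>a b. \<lbrakk>a \<in> pverts H; b \<in> pverts H; \<not> invertible_pair H a b\<rbrakk> \<Longrightarrow> f a b = f b a"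
proof -
  obtain F where F: "avoiding_arcs H `` F \<subseteq> F"
    "\<And>u v. invertible_pair H u v \<Longrightarrow> (u, v) \<in> F"
    "\<And>u v. \<lbrakk>u \<in> pverts H; v \<in> pverts H; u \<noteq> v; \<not> invertible_pair H u v\<rbrakk>
      \<Longrightarrow> (u, v) \<in> F \<longleftrightarrow> (v, u) \<notin> F"
    using exists_closed_selection[OF H] by metis
  define f where "f a b = (if (a, b) \<in> F then a else b)" for a b
  show ?thesis
  proof (rule that[of f])
    fix a b c d assume e: "(a, c) \<in> parcs H" "(b, d) \<in> parcs H"
    \<comment> \<open>Trouble arises only if exactly one of \<open>(a, b)\<close>,
      \<open>(c, d)\<close> is in \<open>F\<close>. The values are then \<open>a\<close>,
      \<open>d\<close> or \<open>b\<close>, \<open>c\<close>, and a missing arc would be an avoiding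
      arc leaving \<open>F\<close>.\<close>
    have "((a, b), (c, d)) \<in> avoiding_arcs H" if "(a, d) \<notin> parcs H"
      unfolding avoiding_arcs_def using e that by (auto intro: exI[of _ Forward])
    moreover have "((c, d), (a, b)) \<in> avoiding_arcs H" if "(b, c) \<notin> parcs H"
      unfolding avoiding_arcs_def using e that by (auto intro: exI[of _ Backward])
    ultimately show "(f a b, f c d) \<in> parcs H"
      using e F(1) unfolding f_def by auto
  next
    fix a b assume "a \<in> pverts H" "b \<in> pverts H" "\<not> invertible_pair H a b"
    then show "f a b = f b a" using F(3)[of a b] unfolding f_def by auto
  qed (use F(2) in \<open>auto simp: f_def\<close>)
qed

section \<open>The ternary polymorphism\<close>

text \<open>These are the three congruent walks that a DAT requires for its entry \<open>u\<close>,
  built from their ends backwards with one common direction per step.\<close>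

inductive distinguishable :: "'a pair_pre_digraph \<Rightarrow> 'a \<Rightarrow> 'a \<Rightarrow> 'a \<Rightarrow> bool" for H where
  invertible: "invertible_pair H s b \<Longrightarrow> distinguishable H s b b"
| step: "\<lbrakk>is_step H d u u'; is_step H d v v'; is_step H d w w';
    \<not> is_step H d u v'; \<not> is_step H d u w'; distinguishable H u' v' w'\<rbrakk> \<Longrightarrow> distinguishable H u v w"

lemma distinguishable_swap: "distinguishable H u v w \<Longrightarrow> distinguishable H u w v"
  by (induction rule: distinguishable.induct) (auto intro: distinguishable.intros)

lemma distinguishable_commute: "distinguishable H u v w \<longleftrightarrow> distinguishable H u w v"
  using distinguishable_swap by metis

lemma distinguishable_distinct:
  assumes "distinguishable H u v w"
  shows "u \<noteq> v" "u \<noteq> w"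
  using assms by (cases; auto simp: invertible_pair_def)+

lemma distinguishable_imp_walks:
  assumes H: "pair_fin_digraph H" and "distinguishable H u v w"
  shows "\<exists>s b P Q Q'. invertible_pair H s b \<and> dwalk_from_to H u P s \<and>
    dwalk_from_to H v Q b \<and> congruent_walks Q P \<and> avoids H P Q \<and>
    dwalk_from_to H w Q' b \<and> congruent_walks Q' P \<and> avoids H P Q'"
  using assms(2)
proof induction
  case (invertible s b)
  then have "dwalk_from_to H s ([s], []) s" "dwalk_from_to H b ([b], []) b"
    by (auto simp: dwalk_from_to_Nil invertible_pair_def)
  with invertible show ?case
    using avoids_Nil unfolding congruent_walks_def by (metis snd_conv)
next
  case (step d u u' v v' w w')
  obtain s b xs ys zs ds where st: "invertible_pair H s b" "dwalk_from_to H u' (xs, ds) s"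
    "dwalk_from_to H v' (ys, ds) b" "avoids H (xs, ds) (ys, ds)"
    "dwalk_from_to H w' (zs, ds) b" "avoids H (xs, ds) (zs, ds)"
    using step.IH by (auto simp: congruent_walks_def)
  have hd: "hd xs = u'" "hd ys = v'" "hd zs = w'" "ys \<noteq> []" "zs \<noteq> []"
    using st by (auto simp: dwalk_from_to_def dwalk_def)
  have "dwalk_from_to H u (u # xs, d # ds) s" "dwalk_from_to H v (v # ys, d # ds) b"
    "dwalk_from_to H w (w # zs, d # ds) b"
    using st step.hyps hd is_step_verts[OF H] by (auto simp: dwalk_from_to_Cons)
  moreover have "avoids H (u # xs, d # ds) (v # ys, d # ds)"
    "avoids H (u # xs, d # ds) (w # zs, d # ds)"
    using avoids_Cons[OF hd(4)] avoids_Cons[OF hd(5)] st step.hyps hd by metis+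
  ultimately show ?case
    using st(1) unfolding congruent_walks_def by (metis snd_conv)
qed

lemma DAT_free_imp_indistinguishable:
  assumes H: "pair_fin_digraph H" and "DAT_free H"
    and V: "u \<in> pverts H" "v \<in> pverts H" "w \<in> pverts H"
  shows "\<not> distinguishable H u v w \<or> \<not> distinguishable H v u w \<or> \<not> distinguishable H w u v"
proof (rule ccontr)
  assume "\<not> ?thesis"
  then have d: "distinguishable H u v w" "distinguishable H v u w" "distinguishable H w u v"
    by auto
  have distinct: "u \<noteq> v" "u \<noteq> w" "v \<noteq> w"
    using d distinguishable_distinct by metis+
  have "\<exists>s b. invertible_pair H s b \<and> (\<exists>P. dwalk_from_to H x P s \<and>
      (\<forall>y \<in> {u, v, w} - {x}. \<exists>Q. dwalk_from_to H y Q b \<and> congruent_walks Q P \<and> avoids H P Q))"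
    if "x \<in> {u, v, w}" for x
    using that d[THEN distinguishable_imp_walks[OF H]] by blast
  \<comment> \<open>Each entry has its own end pair; choice collects these into the functions
    \<open>s\<close> and \<open>b\<close> of a DAT.\<close>
  then obtain s b where sb: "\<And>x. x \<in> {u, v, w} \<Longrightarrow> invertible_pair H (s x) (b x) \<and>
      (\<exists>P. dwalk_from_to H x P (s x) \<and>
      (\<forall>y \<in> {u, v, w} - {x}. \<exists>Q. dwalk_from_to H y Q (b x) \<and> congruent_walks Q P \<and> avoids H P Q))"
    by metis
  have "DAT H u v w s b"
    unfolding DAT_def permutable_triple_def
  proof (intro conjI)
    show "s ` {u, v, w} \<subseteq> pverts H" "b ` {u, v, w} \<subseteq> pverts H"
      using sb unfolding invertible_pair_def by blast+
  qed (use V distinct sb in blast)+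
  then show False using \<open>DAT_free H\<close> unfolding DAT_free_def by blast
qed

section \<open>Selecting an entry of a pairwise equal or invertible triple\<close>

definition equal_or_invertible :: "'a pair_pre_digraph \<Rightarrow> 'a \<Rightarrow> 'a \<Rightarrow> bool" where
  "equal_or_invertible H u v \<longleftrightarrow> u = v \<or> invertible_pair H u v"

text \<open>In a DAT-free digraph the default \<open>w\<close> is indistinguishable too: three
  vertices are never all distinguishable.\<close>

definition select_indistinguishable :: "'a pair_pre_digraph \<Rightarrow> 'a \<Rightarrow> 'a \<Rightarrow> 'a \<Rightarrow> 'a" where
  "select_indistinguishable H u v w =
     (if \<not> distinguishable H u v w then u else if \<not> distinguishable H v u w then v else w)"

text \<open>\<open>x\<close> and \<open>y'\<close> play the selected entries, in any two positions.
  If no arc joins them, both positions are eligible in both triples, so taking the first eligible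
  one cannot have chosen differently.\<close>

lemma indistinguishable_transfer:
  assumes arcs: "(x, x') \<in> parcs H" "(y, y') \<in> parcs H" "(z, z') \<in> parcs H"
    and inv: "equal_or_invertible H x y" "equal_or_invertible H x' y'"
    and ind: "\<not> distinguishable H x y z" "\<not> distinguishable H y' x' z'"
    and no_arc: "(x, y') \<notin> parcs H"
  shows "\<not> distinguishable H x' y' z'" "\<not> distinguishable H y x z"
proof -
  have neq: "x \<noteq> y" "x' \<noteq> y'" using arcs no_arc by auto
  have invs: "invertible_pair H y x" "invertible_pair H x' y'"
    using inv neq invertible_pair_commute unfolding equal_or_invertible_def by metis+
  have xz: "(x, z') \<notin> parcs H"
  proof
    assume "(x, z') \<in> parcs H"
    then have "distinguishable H y' x' z'"
      using distinguishable.step[of H Backward y' y x' x z' x] arcs no_arc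
        distinguishable.invertible[OF invs(1)] by simp
    then show False using ind by blast
  qed
  have zy: "(z, y') \<notin> parcs H"
  proof
    assume "(z, y') \<in> parcs H"
    then have "distinguishable H x y z"
      using distinguishable.step[of H Forward x x' y y' z y'] arcs no_arc
        distinguishable.invertible[OF invs(2)] by simp
    then show False using ind by blast
  qed
  \<comment> \<open>Since \<open>x\<close> avoids \<open>y'\<close> and \<open>z'\<close>,
    distinguishing \<open>x'\<close> would distinguish \<open>x\<close>. Backwards, distinguishing
    \<open>y\<close> would distinguish \<open>y'\<close>.\<close>
  show "\<not> distinguishable H x' y' z'"
    using distinguishable.step[of H Forward x x' y y' z z'] arcs no_arc xz ind by auto
  show "\<not> distinguishable H y x z"
    using distinguishable.step[of H Backward y' y x' x z' z] arcs no_arc zy ind by auto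
qed

lemma select_indistinguishable_arc:
  assumes H: "pair_fin_digraph H" "DAT_free H"
    and arcs: "(x, x') \<in> parcs H" "(y, y') \<in> parcs H" "(z, z') \<in> parcs H"
    and inv: "equal_or_invertible H x y" "equal_or_invertible H x z" "equal_or_invertible H y z"
      "equal_or_invertible H x' y'" "equal_or_invertible H x' z'" "equal_or_invertible H y' z'"
  shows "(select_indistinguishable H x y z, select_indistinguishable H x' y' z') \<in> parcs H"
proof -
  have V: "a \<in> pverts H" "b \<in> pverts H" if "(a, b) \<in> parcs H" for a b
    using is_step_verts[OF H(1), of Forward] that by auto
  note exist = DAT_free_imp_indistinguishable[OF H V(1)[OF arcs(1)] V(1)[OF arcs(2)] V(1)[OF arcs(3)]]
    DAT_free_imp_indistinguishable[OF H V(2)[OF arcs(1)] V(2)[OF arcs(2)] V(2)[OF arcs(3)]]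
  have inv': "equal_or_invertible H y x" "equal_or_invertible H z x" "equal_or_invertible H z y"
      "equal_or_invertible H y' x'" "equal_or_invertible H z' x'" "equal_or_invertible H z' y'"
    using inv invertible_pair_commute unfolding equal_or_invertible_def by metis+
  \<comment> \<open>One instance for each ordered pair of distinct positions; equal positions are
    joined by assumption.\<close>
  note transfer =
    indistinguishable_transfer[OF arcs(1,2,3) inv(1,4)]
    indistinguishable_transfer[OF arcs(1,3,2) inv(2,5)]
    indistinguishable_transfer[OF arcs(2,1,3) inv'(1,4)]
    indistinguishable_transfer[OF arcs(2,3,1) inv(3,6)]
    indistinguishable_transfer[OF arcs(3,1,2) inv'(2,5)]
    indistinguishable_transfer[OF arcs(3,2,1) inv'(3,6)]
  \<comment> \<open>Identifying the two orders of the last arguments makes the remaining case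
    analysis purely propositional.\<close>
  have c: "distinguishable H x z y = distinguishable H x y z"
    "distinguishable H y z x = distinguishable H y x z"
    "distinguishable H z y x = distinguishable H z x y"
    "distinguishable H x' z' y' = distinguishable H x' y' z'"
    "distinguishable H y' z' x' = distinguishable H y' x' z'"
    "distinguishable H z' y' x' = distinguishable H z' x' y'"
    using distinguishable_commute by metis+
  have cases: thesis if "select_indistinguishable H a b e = a \<Longrightarrow> \<not> distinguishable H a b e \<Longrightarrow> thesis"
      "select_indistinguishable H a b e = b \<Longrightarrow> distinguishable H a b e \<Longrightarrow>
        \<not> distinguishable H b a e \<Longrightarrow> thesis"
      "select_indistinguishable H a b e = e \<Longrightarrow> distinguishable H a b e \<Longrightarrow>
        distinguishable H b a e \<Longrightarrow> thesis" for a b e thesis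
    using that unfolding select_indistinguishable_def by argo
  show ?thesis
    by (rule cases[of x y z]; rule cases[of x' y' z']; simp only:; use transfer[unfolded c] exist arcs in argo)
qed

text \<open>A repeated entry is never distinguishable, as it would have to avoid itself. A single
  entry invertible with the repeated one is distinguishable by walks of length zero, so it is passed
  over.\<close>

lemma select_indistinguishable_majority:
  assumes "equal_or_invertible H a b"
  shows "select_indistinguishable H a a b = a" "select_indistinguishable H a b a = a"
    "select_indistinguishable H b a a = a"
  using assms distinguishable.invertible[of H b a] distinguishable_distinct[of H a a b]
    distinguishable_distinct[of H a b a] invertible_pair_commute[of H a b]
  unfolding select_indistinguishable_def equal_or_invertible_def by auto

section \<open>Retracting triples by merging coordinates\<close>

text \<open>
  The first two coordinates are merged twice since \<open>(n, y, n)\<close> may become \<open>(n, y, y)\<close> when the last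
  two are merged.
\<close>

definition merge_coordinates :: "('a \<Rightarrow> 'a \<Rightarrow> 'a) \<Rightarrow> 'a \<times> 'a \<times> 'a \<Rightarrow> 'a \<times> 'a \<times> 'a" where
  "merge_coordinates f = (\<lambda>(x, y, z). (f x y, f y x, z)) \<circ> (\<lambda>(x, y, z). (x, f y z, f z y)) \<circ>
     (\<lambda>(x, y, z). (f x z, y, f z x)) \<circ> (\<lambda>(x, y, z). (f x y, f y x, z))"

lemma merge_coordinates_equal_or_invertible:
  assumes cons: "\<And>a b. f a b \<in> {a, b}"
    and first: "\<And>a b. invertible_pair H a b \<Longrightarrow> f a b = a"
    and comm: "\<And>a b. \<lbrakk>a \<in> V; b \<in> V; \<not> invertible_pair H a b\<rbrakk> \<Longrightarrow> f a b = f b a"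
    and V: "x \<in> V" "y \<in> V" "z \<in> V" and m: "merge_coordinates f (x, y, z) = (a, b, c)"
  shows "equal_or_invertible H a b" "equal_or_invertible H a c" "equal_or_invertible H b c"
proof -
  have sym: "\<And>a b. invertible_pair H a b \<Longrightarrow> invertible_pair H b a"
    by (simp add: invertible_pair_commute)
  have id: "f a a = a" for a using cons by auto
  \<comment> \<open>Merging makes an incompatible pair equal and, by \<open>keep\<close>, leaves a
    compatible one unchanged.\<close>
  have merge: "equal_or_invertible H a b \<or> f a b = f b a" if "a \<in> V" "b \<in> V" for a b
    using that comm unfolding equal_or_invertible_def by blast
  have keep: "f a b = a" "f b a = b" if "equal_or_invertible H a b" for a b
    using that first sym id unfolding equal_or_invertible_def by auto
  have closed: "f a b \<in> V" if "a \<in> V" "b \<in> V" for a b using cons[of a b] that by auto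
  have cons': "f a b = a \<or> f a b = b" for a b using cons by auto
  have eq_sym: "equal_or_invertible H b a" if "equal_or_invertible H a b" for a b
    using that sym by (auto simp: equal_or_invertible_def)
  have refl: "equal_or_invertible H a a" for a by (simp add: equal_or_invertible_def)
  define x1 y1 where 1: "x1 = f x y" "y1 = f y x"
  define x2 z2 where 2: "x2 = f x1 z" "z2 = f z x1"
  define y3 z3 where 3: "y3 = f y1 z2" "z3 = f z2 y1"
  have abc: "a = f x2 y3" "b = f y3 x2" "c = z3"
    using m by (auto simp: merge_coordinates_def 1 2 3)
  have V': "x1 \<in> V" "y1 \<in> V" "z2 \<in> V"
    using V closed 1 2 by auto
  have "equal_or_invertible H a b \<and> equal_or_invertible H a c \<and> equal_or_invertible H b c"
  proof (cases "equal_or_invertible H x y")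
    case xy: True
    then have xy1: "x1 = x" "y1 = y" using keep 1 by auto
    show ?thesis
    proof (cases "equal_or_invertible H x z")
      case xz: True
      then have xz2: "x2 = x" "z2 = z" using keep 2 xy1 by auto
      \<comment> \<open>The last two entries stay or collapse to one of them; either way they remain
        compatible with \<open>x\<close>.\<close>
      have "y3 = y \<and> z3 = z \<and> equal_or_invertible H y z \<or> y3 = z3 \<and> (y3 = y \<or> y3 = z)"
        using merge[OF V(2,3)] keep cons' unfolding 3 xy1 xz2 by metis
      moreover from this have "a = x" "b = y3"
        using keep[OF xy] keep[OF xz] unfolding abc xz2 by auto
      ultimately show ?thesis using xy xz refl abc(3) by auto
    next
      case False
      then have n: "x2 = z2" using merge[OF V(1,3)] unfolding 2 xy1 by auto
      show ?thesis
      proof (cases "equal_or_invertible H y z2")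
        case True
        then show ?thesis using keep[OF True] eq_sym[OF True] refl unfolding abc n 3 xy1 by simp
      next
        case False
        \<comment> \<open>From \<open>(n, y, n)\<close> the third merge produces
          \<open>(n, m, m)\<close> with \<open>m\<close> the common value of \<open>f\<close> on
          \<open>n\<close>, \<open>y\<close>; the final merge turns \<open>n\<close> into
          \<open>m\<close>.\<close>
        then have e: "f y z2 = f z2 y" using merge V(2) V'(3) by blast
        show ?thesis
          using cons'[of y z2] e id refl unfolding abc n 3 xy1 by auto
      qed
    qed
  next
    case False
    then have p: "x1 = y1" using merge[OF V(1,2)] unfolding 1 by auto
    show ?thesis
    proof (cases "equal_or_invertible H y1 z")
      case True
      then show ?thesis
        using keep[OF True] refl id unfolding abc 3 2 p by auto
    next
      case False
      then have e: "f y1 z = f z y1" using merge V(3) V'(2) by blast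
      show ?thesis
        using cons'[of z y1] e id refl unfolding abc 3 2 p by auto
    qed
  qed
  then show "equal_or_invertible H a b" "equal_or_invertible H a c" "equal_or_invertible H b c"
    by auto
qed

section \<open>Assembling the two polymorphisms\<close>

theorem theorem7:
  fixes H :: "'a pair_pre_digraph"
  assumes "pair_fin_digraph H"
    and "DAT_free H"
  shows "\<exists>f g. polymorphism H 2 f \<and> polymorphism H 3 g \<and>
    (\<forall>u \<in> pverts H. \<forall>v \<in> pverts H. u \<noteq> v \<longrightarrow>
      (\<not> invertible_pair H u v \<longrightarrow> semilattice_on f {u, v}) \<and>
      (invertible_pair H u v \<longrightarrow> majority_on g {u, v}))"
proof -
  let ?V = "pverts H"
  obtain h where cons: "\<And>a b. h a b \<in> {a, b}"
    and arc: "\<And>a b c d. \<lbrakk>(a, c) \<in> parcs H; (b, d) \<in> parcs H\<rbrakk> \<Longrightarrow> (h a b, h c d) \<in> parcs H"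
    and first: "\<And>a b. invertible_pair H a b \<Longrightarrow> h a b = a"
    and comm: "\<And>a b. \<lbrakk>a \<in> ?V; b \<in> ?V; \<not> invertible_pair H a b\<rbrakk> \<Longrightarrow> h a b = h b a"
    using exists_binary_polymorphism[OF assms(1)] by metis
  define f where "f us = h (us ! 0) (us ! 1)" for us
  define g where "g us = (case merge_coordinates h (us ! 0, us ! 1, us ! 2) of
    (a, b, c) \<Rightarrow> select_indistinguishable H a b c)" for us
  have id: "h a a = a" for a using cons by auto
  have f: "polymorphism H 2 f"
    unfolding polymorphism_def
  proof (intro conjI allI impI)
    fix us assume us: "length us = 2 \<and> set us \<subseteq> ?V"
    then have "us ! 0 \<in> ?V" "us ! 1 \<in> ?V" by (auto simp: subset_iff)
    then show "f us \<in> ?V" using cons[of "us ! 0" "us ! 1"] unfolding f_def by auto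
  qed (auto simp: f_def intro: arc)
  have g: "polymorphism H 3 g"
    unfolding polymorphism_def
  proof (intro conjI allI impI)
    fix us assume us: "length us = 3 \<and> set us \<subseteq> ?V"
    obtain a b c where m: "merge_coordinates h (us ! 0, us ! 1, us ! 2) = (a, b, c)"
      using prod_cases3 by blast
    have V: "us ! 0 \<in> ?V" "us ! 1 \<in> ?V" "us ! 2 \<in> ?V" using us by (auto simp: subset_iff)
    have closed: "h p q \<in> ?V" if "p \<in> ?V" "q \<in> ?V" for p q using cons[of p q] that by auto
    have "a \<in> ?V" "b \<in> ?V" "c \<in> ?V"
      using m V closed unfolding merge_coordinates_def by auto
    then show "g us \<in> ?V" using m by (auto simp: g_def select_indistinguishable_def)
  next
    fix us vs assume *: "length us = 3 \<and> length vs = 3 \<and> (\<forall>i<3. (us ! i, vs ! i) \<in> parcs H)"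
    obtain a b c where m: "merge_coordinates h (us ! 0, us ! 1, us ! 2) = (a, b, c)"
      using prod_cases3 by blast
    obtain a' b' c' where m': "merge_coordinates h (vs ! 0, vs ! 1, vs ! 2) = (a', b', c')"
      using prod_cases3 by blast
    have E: "(us ! 0, vs ! 0) \<in> parcs H" "(us ! 1, vs ! 1) \<in> parcs H" "(us ! 2, vs ! 2) \<in> parcs H"
      using * by auto
    have V: "p \<in> ?V" "q \<in> ?V" if "(p, q) \<in> parcs H" for p q
      using is_step_verts[OF assms(1), of Forward] that by auto
    have "(a, a') \<in> parcs H" "(b, b') \<in> parcs H" "(c, c') \<in> parcs H"
      using m m' E unfolding merge_coordinates_def by (auto intro!: arc)
    then show "(g us, g vs) \<in> parcs H"
      unfolding g_def m m' prod.case
      using select_indistinguishable_arc[OF assms]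
        merge_coordinates_equal_or_invertible[OF cons first comm E[THEN V(1)] m]
        merge_coordinates_equal_or_invertible[OF cons first comm E[THEN V(2)] m'] by blast
  qed
  \<comment> \<open>On two elements, a commutative operation with values among its arguments is a
    minimum for one of the two orders.\<close>
  have "semilattice_on f {u, v}" if "u \<in> ?V" "v \<in> ?V" "\<not> invertible_pair H u v" for u v
    using cons[of u v] comm[OF that] id unfolding semilattice_on_def f_def by auto
  moreover have "majority_on g {u, v}" if "invertible_pair H u v" for u v
  proof -
    \<comment> \<open>On an invertible pair \<open>h\<close> is the first projection, so merging
      changes nothing and only the selection remains.\<close>
    have "g [a, b, c] = select_indistinguishable H a b c" if "a \<in> {u, v}" "b \<in> {u, v}" "c \<in> {u, v}" for a b c
    proof -
      have "h p q = p" if "p \<in> {u, v}" "q \<in> {u, v}" for p q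
        using that first \<open>invertible_pair H u v\<close> id invertible_pair_commute by (metis empty_iff insert_iff)
      then show ?thesis using that unfolding g_def merge_coordinates_def by simp
    qed
    moreover have "equal_or_invertible H a b" if "a \<in> {u, v}" "b \<in> {u, v}" for a b
      using that \<open>invertible_pair H u v\<close> invertible_pair_commute unfolding equal_or_invertible_def
      by (metis empty_iff insert_iff)
    ultimately show ?thesis
      unfolding majority_on_def by (simp add: select_indistinguishable_majority)
  qed
  ultimately show ?thesis using f g by blast
qed

end
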